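(* For every $p\in\mathbb{Z}$ and every integer $n\ge 0$, $$\beta_{n,\lambda}^{(p)}(x)=\sum_{k=0}^{n}\frac{(-\lambda)^{k}(1)_{k+1,1/\lambda}}{(k+1)^{p}\,k!}\sum_{l=0}^{k}\binom{k}{l}(-1)^{l}(x-l)_{n,-\lambda}.$$
   Context: Let $\lambda$ be a nonzero real number. For $\mu\in\mathbb{R}$, $(x)_{0,\mu}=1$, $(x)_{n,\mu}=x(x-\mu)\cdots(x-(n-1)\mu)$ for $n\ge1$, and $e_\mu^x(t)=\sum_{k\ge0}(x)_{k,\mu}t^k/k!$ (formal power series in $t$), $e_\mu(t)=e_\mu^1(t)$. For $k\in\mathbb{Z}$, the degenerate polylogarithm is $\mathrm{Li}_{k,\lambda}(y)=\sum_{n\ge1}\frac{(-\lambda)^{n-1}(1)_{n,1/\lambda}}{(n-1)!\,n^k}y^n$. The degenerate poly-Bernoulli polynomials of index $k$ are defined by $\frac{\mathrm{Li}_{k,\lambda}(1-e_\lambda(-t))}{1-e_\lambda(-t)}e_\lambda^{-x}(-t)=\sum_{n\ge0}\beta^{(k)}_{n,\lambda}(x)\frac{t^n}{n!}$. *)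

theory Defs
  imports Complex_Main "HOL-Computational_Algebra.Formal_Power_Series"
begin

definition deg_falling :: "real \<Rightarrow> nat \<Rightarrow> real \<Rightarrow> real" where
  "deg_falling x n \<mu> = (\<Prod>i<n. x - real i * \<mu>)"

definition deg_exp :: "real \<Rightarrow> real \<Rightarrow> real fps" where
  "deg_exp \<mu> x = Abs_fps (\<lambda>k. deg_falling x k \<mu> / fact k)"

definition deg_polylog :: "int \<Rightarrow> real \<Rightarrow> real fps" where
  "deg_polylog k lam = Abs_fps (\<lambda>n. if n = 0 then 0
     else (- lam) ^ (n - 1) * deg_falling 1 n (1 / lam) / (fact (n - 1) * real n powi k))"

text \<open>Composition with \<open>- fps_X\<close> is the substitution of \<open>-t\<close> for \<open>t\<close>. The series
  \<open>1 - deg_exp lam 1 oo (- fps_X)\<close> has order 1, so the outer composition is meaningful and the quotient of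
  power series is exact.\<close>

definition deg_poly_Bernoulli_gf :: "int \<Rightarrow> real \<Rightarrow> real \<Rightarrow> real fps" where
  "deg_poly_Bernoulli_gf k lam x =
     (let y = 1 - (deg_exp lam 1 oo (- fps_X))
      in (deg_polylog k lam oo y) / y * (deg_exp lam (- x) oo (- fps_X)))"

definition deg_poly_Bernoulli :: "int \<Rightarrow> nat \<Rightarrow> real \<Rightarrow> real \<Rightarrow> real" where
  "deg_poly_Bernoulli k n lam x = fact n * fps_nth (deg_poly_Bernoulli_gf k lam x) n"

lemma deg_poly_Bernoulli_gf_eq:
  "deg_poly_Bernoulli_gf k lam x = Abs_fps (\<lambda>n. deg_poly_Bernoulli k n lam x / fact n)"
  by (simp add: fps_eq_iff deg_poly_Bernoulli_def)

lemma deg_poly_Bernoulli_quotient_exact: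
  fixes lam :: real
  defines "y \<equiv> 1 - (deg_exp lam 1 oo (- fps_X))"
  shows "fps_nth y 0 = 0" and "fps_nth y 1 = 1"
    and "(deg_polylog k lam oo y) / y * y = deg_polylog k lam oo y"
proof -
  show y0: "fps_nth y 0 = 0"
    by (simp add: y_def deg_exp_def deg_falling_def)
  show y1: "fps_nth y 1 = 1"
    by (simp add: y_def deg_exp_def deg_falling_def fps_compose_nth)
  have "y \<noteq> 0" using y1 by auto
  moreover have "subdegree y = 1"
    using y0 y1 by (intro subdegreeI) auto
  moreover have "fps_nth (deg_polylog k lam oo y) 0 = 0"
    by (simp add: deg_polylog_def)
  ultimately have "y dvd (deg_polylog k lam oo y)"
    by (cases "deg_polylog k lam oo y = 0")
       (auto simp: fps_dvd_iff Suc_le_eq subdegree_eq_0_iff intro!: gr0I)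
  then show "(deg_polylog k lam oo y) / y * y = deg_polylog k lam oo y"
    by (rule dvd_div_mult_self)
qed

end

theory Submission
  imports Defs
begin

text \<open>
  Substituting \<open>- t\<close> for \<open>t\<close> in \<open>e\<^sub>\<lambda>\<^sup>a(t)\<close> gives \<open>e\<^sub>-\<^sub>\<lambda>\<^sup>-\<^sup>a(t)\<close>, so with \<open>E a = deg_exp (- lam) a\<close> the
  generating function is \<open>A(y) * E x\<close>, where \<open>y = 1 - E (- 1)\<close> and \<open>A(y) = Li(y) / y\<close>.
  Since \<open>E a * E b = E (a + b)\<close>, the binomial theorem expands \<open>y ^ k * E x\<close> into the alternating sum
  of the \<open>E (x - l)\<close>, and the sum over \<open>k\<close> stops at \<open>n\<close> because \<open>y\<close> has order 1.
\<close>

lemma deg_falling_Suc: "deg_falling x (Suc n) \<mu> = deg_falling x n \<mu> * (x - real n * \<mu>)"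
  by (simp add: deg_falling_def)

lemma deg_exp_nth: "fps_nth (deg_exp \<mu> x) n = deg_falling x n \<mu> / fact n"
  by (simp add: deg_exp_def)

lemma deg_exp_0_right: "deg_exp \<mu> 0 = 1"
  by (rule fps_ext) (auto simp: deg_exp_nth deg_falling_def prod_zero_iff)

text \<open>Each of the \<open>n\<close> factors absorbs one sign: -(a - i\<mu>) = (-a) -
  i(-\<mu>).\<close>

lemma deg_exp_compose_uminus: "deg_exp \<mu> a oo (- fps_X) = deg_exp (- \<mu>) (- a)"
proof (rule fps_ext)
  fix n
  have "(- 1) ^ n * deg_falling a n \<mu> = deg_falling (- a) n (- \<mu>)"
    by (induction n) (simp_all add: deg_falling_Suc, simp_all add: deg_falling_def algebra_simps)
  then show "fps_nth (deg_exp \<mu> a oo (- fps_X)) n = fps_nth (deg_exp (- \<mu>) (- a)) n"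
    by (simp add: fps_compose_uminus' deg_exp_nth)
qed

text \<open>For \<mu> nonzero this is the equation of (1 + \<mu>t)^(c/\<mu>). On coefficients it is
  the recurrence \<open>deg_falling_Suc\<close>.\<close>

lemma deg_exp_deriv:
  "(1 + fps_const \<mu> * fps_X) * fps_deriv (deg_exp \<mu> c) = fps_const c * deg_exp \<mu> c"
proof (rule fps_ext)
  fix n
  show "fps_nth ((1 + fps_const \<mu> * fps_X) * fps_deriv (deg_exp \<mu> c)) n
      = fps_nth (fps_const c * deg_exp \<mu> c) n"
    by (cases n)
      (simp_all add: distrib_right mult.assoc deg_exp_nth deg_falling_Suc field_simps del: of_nat_Suc)
qed

text \<open>Comparing coefficients gives (n+1) g(n+1) = (c - n\<mu>) g(n), so the constant term
  determines the whole series.\<close>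

lemma deg_exp_unique:
  assumes "fps_nth G 0 = 1"
    and ode: "(1 + fps_const \<mu> * fps_X) * fps_deriv G = fps_const c * G"
  shows "G = deg_exp \<mu> c"
proof (rule fps_ext)
  fix n
  show "fps_nth G n = fps_nth (deg_exp \<mu> c) n"
  proof (induction n)
    case 0
    then show ?case using assms(1) by (simp add: deg_exp_nth deg_falling_def)
  next
    case (Suc n)
    have "fps_nth ((1 + fps_const \<mu> * fps_X) * fps_deriv G) n = c * fps_nth G n"
      by (simp add: ode)
    then have "real (Suc n) * fps_nth G (Suc n) = (c - real n * \<mu>) * fps_nth G n"
      by (cases n) (simp_all add: distrib_right mult.assoc algebra_simps)
    then have "fps_nth G (Suc n) = (c - real n * \<mu>) * fps_nth G n / real (Suc n)"
      by (simp add: field_simps del: of_nat_Suc)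
    then show ?case
      by (simp add: Suc.IH deg_exp_nth deg_falling_Suc field_simps del: of_nat_Suc)
  qed
qed

text \<open>By the product rule the right-hand side solves the differential equation with constant a
  + b, so uniqueness replaces a Vandermonde-type convolution.\<close>

lemma deg_exp_add: "deg_exp \<mu> (a + b) = deg_exp \<mu> a * deg_exp \<mu> b"
proof (rule deg_exp_unique [symmetric])
  show "fps_nth (deg_exp \<mu> a * deg_exp \<mu> b) 0 = 1"
    by (simp add: deg_exp_nth deg_falling_def)
  let ?D = "1 + fps_const \<mu> * fps_X"
  have "?D * fps_deriv (deg_exp \<mu> a * deg_exp \<mu> b)
      = deg_exp \<mu> a * (?D * fps_deriv (deg_exp \<mu> b)) + (?D * fps_deriv (deg_exp \<mu> a)) * deg_exp \<mu> b"
    by (simp add: algebra_simps)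
  also have "\<dots> = (fps_const a + fps_const b) * (deg_exp \<mu> a * deg_exp \<mu> b)"
    by (simp only: deg_exp_deriv) (simp add: algebra_simps del: fps_const_add)
  finally show "?D * fps_deriv (deg_exp \<mu> a * deg_exp \<mu> b)
      = fps_const (a + b) * (deg_exp \<mu> a * deg_exp \<mu> b)"
    by simp
qed

lemma deg_exp_power: "deg_exp \<mu> a ^ l = deg_exp \<mu> (real l * a)"
  by (induction l) (simp_all add: deg_exp_0_right deg_exp_add distrib_right)

lemma one_minus_deg_exp_power_mult:
  "(1 - deg_exp \<mu> (- 1)) ^ k * deg_exp \<mu> x
    = (\<Sum>l=0..k. fps_const (real (k choose l) * (- 1) ^ l) * deg_exp \<mu> (x - real l))"
proof -
  have sgn: "(- deg_exp \<mu> (- 1)) ^ l = fps_const ((- 1) ^ l) * deg_exp \<mu> (- real l)" for l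
    by (subst power_minus) (simp add: deg_exp_power fps_const_power [symmetric]
        del: fps_const_power flip: fps_const_neg)
  have "(1 - deg_exp \<mu> (- 1)) ^ k = (- deg_exp \<mu> (- 1) + 1) ^ k"
    by simp
  also have "\<dots> = (\<Sum>l=0..k. of_nat (k choose l) * (- deg_exp \<mu> (- 1)) ^ l)"
    by (subst binomial_ring) (simp add: atLeast0AtMost)
  also have "\<dots> = (\<Sum>l=0..k. fps_const (real (k choose l) * (- 1) ^ l) * deg_exp \<mu> (- real l))"
    by (simp add: sgn fps_of_nat mult.assoc flip: fps_const_mult)
  finally show ?thesis
    by (simp add: sum_distrib_right mult.assoc flip: deg_exp_add)
qed

text \<open>Although \<open>A oo y\<close> is an infinite sum of powers of \<open>y\<close>, only
  those with k \<le> n reach coefficient n.\<close>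

lemma fps_compose_mult_nth:
  fixes A y G :: "'a :: idom fps"
  assumes "fps_nth y 0 = 0"
  shows "fps_nth ((A oo y) * G) n = (\<Sum>k=0..n. fps_nth A k * fps_nth (y ^ k * G) n)"
proof -
  \<comment> \<open>The coefficient is a sum over k \<le> i. The terms with k > i vanish, since
    \<open>y ^ k\<close> has order at least k; a range independent of i allows the swap of sums
    below.\<close>
  have "fps_nth (A oo y) i = (\<Sum>k=0..n. fps_nth A k * fps_nth (y ^ k) i)" if "i \<le> n" for i
    unfolding fps_compose_nth
    by (rule sum.mono_neutral_left) (use that startsby_zero_power_prefix [OF assms] in auto)
  then have "fps_nth ((A oo y) * G) n
      = (\<Sum>i=0..n. \<Sum>k=0..n. fps_nth A k * fps_nth (y ^ k) i * fps_nth G (n - i))"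
    by (simp add: fps_mult_nth sum_distrib_right)
  also have "\<dots> = (\<Sum>k=0..n. \<Sum>i=0..n. fps_nth A k * fps_nth (y ^ k) i * fps_nth G (n - i))"
    by (rule sum.swap)
  finally show ?thesis
    by (simp add: fps_mult_nth sum_distrib_left mult.assoc)
qed

theorem theorem8:
  fixes lam x :: real and p :: int and n :: nat
  assumes "lam \<noteq> 0"
  shows "deg_poly_Bernoulli p n lam x =
    (\<Sum>k=0..n. (- lam) ^ k * deg_falling 1 (k + 1) (1 / lam) / (real (k + 1) powi p * fact k) *
      (\<Sum>l=0..k. real (k choose l) * (- 1) ^ l * deg_falling (x - real l) n (- lam)))"
proof -
  define y where "y = 1 - deg_exp (- lam) (- 1)"
  \<comment> \<open>The polylogarithm series divided by its variable: the index is shifted down by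
    one, which is why k + 1 appears in the formula.\<close>
  define A where "A = Abs_fps (\<lambda>k. (- lam) ^ k * deg_falling 1 (k + 1) (1 / lam)
    / (real (k + 1) powi p * fact k))"
  have y0: "fps_nth y 0 = 0" and "y \<noteq> 0"
    using deg_poly_Bernoulli_quotient_exact(1,2) [of lam]
    by (auto simp: y_def deg_exp_compose_uminus)
  have "deg_polylog p lam = fps_X * A"
    by (rule fps_ext) (simp add: deg_polylog_def A_def mult.commute)
  \<comment> \<open>Composition turns \<open>fps_X * A\<close> into \<open>y * (A oo y)\<close>, and
    the nonzero factor \<open>y\<close> cancels.\<close>
  then have "(deg_polylog p lam oo y) / y = A oo y"
    using y0 \<open>y \<noteq> 0\<close> by (simp add: fps_compose_mult_distrib)
  then have "deg_poly_Bernoulli_gf p lam x = (A oo y) * deg_exp (- lam) x"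
    by (simp add: deg_poly_Bernoulli_gf_def Let_def deg_exp_compose_uminus flip: y_def)
  then have "deg_poly_Bernoulli p n lam x
      = (\<Sum>k=0..n. fps_nth A k * (fact n * fps_nth (y ^ k * deg_exp (- lam) x) n))"
    by (simp add: deg_poly_Bernoulli_def fps_compose_mult_nth [OF y0] sum_distrib_left mult_ac)
  \<comment> \<open>The factor \<open>fact n\<close> cancels the denominator in the coefficients of
    \<open>deg_exp\<close>.\<close>
  moreover have "fact n * fps_nth (y ^ k * deg_exp (- lam) x) n
      = (\<Sum>l=0..k. real (k choose l) * (- 1) ^ l * deg_falling (x - real l) n (- lam))" for k
    by (simp add: y_def one_minus_deg_exp_power_mult fps_sum_nth deg_exp_nth sum_distrib_left)
  ultimately show ?thesis
    by (simp add: A_def)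
qed

end
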